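(* Let $\Delta$ be a simplicial complex on $[n]$, let $\mathcal S\subset 2^{[n]}$, and let $I\subset[n]$. If $\mathrm{conv}\{\mathbf u^S : S\in\mathcal S\}$ is a face of $\mathrm{Marg}(\Delta)$, then $\mathrm{conv}\{\mathbf u^{S\triangle I} : S\in\mathcal S\}$ is also a face of $\mathrm{Marg}(\Delta)$. Likewise, if $\mathrm{conv}\{\mathbf v^S : S\in\mathcal S\}$ is a face of $\mathrm{Corr}(\Delta)$, then $\mathrm{conv}\{\mathbf v^{S\triangle I} : S\in\mathcal S\}$ is also a face of $\mathrm{Corr}(\Delta)$.
   Context: For a simplicial complex $\Delta$ on $[n]$ (a nonempty family of subsets of $[n]$ closed under taking subsets), $\overline\Delta=\Delta\setminus\{\emptyset\}$, $\mathrm{facets}(\Delta)$ is the set of inclusion-maximal faces, and $\mathcal E(\Delta)=\{(H,F) : H\subset F\in\mathrm{facets}(\Delta)\}$. $\triangle$ is symmetric difference. Binary marginal polytope: $\mathrm{Marg}(\Delta)=\mathrm{conv}\{\mathbf u^S : S\subset[n]\}\subset\mathbb R^{\mathcal E(\Delta)}$, where $u^S_{(H,F)}=1$ if $S\cap F=H$ and $0$ otherwise. Correlation polytope: $\mathrm{Corr}(\Delta)=\mathrm{conv}\{\mathbf v^S : S\subset[n]\}\subset\mathbb R^{\overline\Delta}$, where $v^S_F=1$ if $F\subset S$ and $0$ otherwise. *)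

theory Defs
  imports "HOL-Analysis.Analysis" "HOL-Analysis.Finite_Function_Topology"
begin

text \<open>The ground set \<open>[n]\<close> is \<open>{1..n}\<close>. As usual in this setting, the inclusion
  signs in the definitions of faces, facets and generators are non-strict.\<close>

definition simplicial_complex_on :: "nat \<Rightarrow> nat set set \<Rightarrow> bool" where
  "simplicial_complex_on n \<Delta> \<longleftrightarrow>
     \<Delta> \<noteq> {} \<and> \<Delta> \<subseteq> Pow {1..n} \<and> (\<forall>F\<in>\<Delta>. \<forall>G. G \<subseteq> F \<longrightarrow> G \<in> \<Delta>)"

definition nonempty_faces :: "nat set set \<Rightarrow> nat set set" where
  "nonempty_faces \<Delta> = \<Delta> - {{}}"

definition facets :: "nat set set \<Rightarrow> nat set set" where
  "facets \<Delta> = {F \<in> \<Delta>. \<forall>G\<in>\<Delta>. F \<subseteq> G \<longrightarrow> G = F}"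

definition marg_index :: "nat set set \<Rightarrow> (nat set \<times> nat set) set" where
  "marg_index \<Delta> = {(H, F). H \<subseteq> F \<and> F \<in> facets \<Delta>}"

text \<open>For a finite index set \<open>A\<close> the space \<open>\<real>\<^sup>A\<close> is represented as the subspace of
  finitely supported functions that vanish outside \<open>A\<close>. The index sets used here depend on
  \<open>\<Delta>\<close>, so they cannot be types, while finitely supported functions form a
  \<^class>\<open>real_vector\<close>, which is what \<^const>\<open>convex\<close> \<^const>\<open>hull\<close> and \<^const>\<open>face_of\<close>
  require. Both are intrinsic to the polytope: padding with zero coordinates does not
  affect them.\<close>

definition coord_vec :: "'i set \<Rightarrow> ('i \<Rightarrow> real) \<Rightarrow> ('i \<Rightarrow>\<^sub>0 real)" where
  "coord_vec A f = (\<Sum>i\<in>A. Poly_Mapping.single i (f i))"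

lemma lookup_coord_vec:
  assumes "finite A"
  shows "Poly_Mapping.lookup (coord_vec A f) i = (if i \<in> A then f i else 0)"
  using assms by (simp add: coord_vec_def lookup_sum lookup_single when_def)

definition marg_vertex :: "nat set set \<Rightarrow> nat set \<Rightarrow> (nat set \<times> nat set \<Rightarrow>\<^sub>0 real)" where
  "marg_vertex \<Delta> S = coord_vec (marg_index \<Delta>) (\<lambda>(H, F). if S \<inter> F = H then 1 else 0)"

definition corr_vertex :: "nat set set \<Rightarrow> nat set \<Rightarrow> (nat set \<Rightarrow>\<^sub>0 real)" where
  "corr_vertex \<Delta> S = coord_vec (nonempty_faces \<Delta>) (\<lambda>F. if F \<subseteq> S then 1 else 0)"

definition Marg :: "nat \<Rightarrow> nat set set \<Rightarrow> (nat set \<times> nat set \<Rightarrow>\<^sub>0 real) set" where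
  "Marg n \<Delta> = convex hull {marg_vertex \<Delta> S | S. S \<subseteq> {1..n}}"

definition Corr :: "nat \<Rightarrow> nat set set \<Rightarrow> (nat set \<Rightarrow>\<^sub>0 real) set" where
  "Corr n \<Delta> = convex hull {corr_vertex \<Delta> S | S. S \<subseteq> {1..n}}"

lemma finite_nonempty_faces:
  assumes "simplicial_complex_on n \<Delta>"
  shows "finite (nonempty_faces \<Delta>)"
proof -
  have "nonempty_faces \<Delta> \<subseteq> Pow {1..n}"
    using assms by (auto simp: simplicial_complex_on_def nonempty_faces_def)
  then show ?thesis
    by (rule finite_subset) simp
qed

lemma finite_marg_index:
  assumes "simplicial_complex_on n \<Delta>"
  shows "finite (marg_index \<Delta>)"
proof -
  have "F \<subseteq> {1..n}" if "F \<in> facets \<Delta>" for F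
    using assms that by (auto simp: simplicial_complex_on_def facets_def)
  then have "marg_index \<Delta> \<subseteq> Pow {1..n} \<times> Pow {1..n}"
    unfolding marg_index_def by blast
  then show ?thesis
    by (rule finite_subset) simp
qed

text \<open>On a simplicial complex the index sets are finite, so the coordinates are the intended ones.\<close>

lemma lookup_marg_vertex:
  assumes "simplicial_complex_on n \<Delta>" "(H, F) \<in> marg_index \<Delta>"
  shows "Poly_Mapping.lookup (marg_vertex \<Delta> S) (H, F) = (if S \<inter> F = H then 1 else 0)"
  using assms finite_marg_index[OF assms(1)] by (simp add: marg_vertex_def lookup_coord_vec)

lemma lookup_corr_vertex:
  assumes "simplicial_complex_on n \<Delta>" "F \<in> nonempty_faces \<Delta>"
  shows "Poly_Mapping.lookup (corr_vertex \<Delta> S) F = (if F \<subseteq> S then 1 else 0)"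
  using assms finite_nonempty_faces[OF assms(1)] by (simp add: corr_vertex_def lookup_coord_vec)

end

theory Submission
  imports Defs
begin

text \<open>
  Passing from \<open>S\<close> to \<open>S \<triangle> I\<close> permutes the generators of either polytope, and this permutation is
  the restriction of an affine map of the ambient space. Such a map is an affine involution of the
  polytope, hence carries faces to faces.

  For the marginal polytope the map is a permutation of coordinates: \<open>(S \<triangle> I) \<inter> F = H\<close> iff
  \<open>S \<inter> F = H \<triangle> (I \<inter> F)\<close>, so the coordinate at \<open>(H, F)\<close> is replaced by the one at
  \<open>(H \<triangle> (I \<inter> F), F)\<close>. For the correlation polytope, coordinates are products of the indicators
  \<open>[j \<in> S]\<close>, and toggling a single element \<open>i\<close> replaces \<open>[i \<in> S]\<close> by \<open>1 - [i \<in> S]\<close>. At a face \<open>F\<close>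
  containing \<open>i\<close> this turns the coordinate \<open>x\<^sub>F\<close> into \<open>x\<^bsub>F - {i}\<^esub> - x\<^sub>F\<close>, where \<open>x\<^bsub>{}\<^esub>\<close> stands for the
  constant 1, which is why the map is affine and not linear. A general \<open>I\<close> is reached by toggling its
  elements one after the other.
\<close>

text \<open>The convex hull of the points \<open>v S\<close> inherits the involution \<open>\<sigma>\<close> of the index set: an affine
  map whose square fixes the generators fixes everything in their hull. Pulling a segment back
  through the involution turns the defining property of the face into that of its image. The
  affine map need not be injective on the whole space: the coordinate maps below annihilate many
  vectors supported outside the index set of the polytope.\<close>

lemma face_of_convex_hull_affine_involution:
  fixes f :: "'b::real_vector \<Rightarrow> 'b" and v :: "'a \<Rightarrow> 'b"
  assumes lin: "linear f"
    and act: "\<And>S. S \<in> K \<Longrightarrow> c + f (v S) = v (\<sigma> S)"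
    and inv: "\<And>S. S \<in> K \<Longrightarrow> \<sigma> (\<sigma> S) = S" "\<And>S. S \<in> K \<Longrightarrow> \<sigma> S \<in> K"
    and sub: "\<S> \<subseteq> K"
    and face: "(convex hull (v ` \<S>)) face_of (convex hull (v ` K))"
  shows "(convex hull ((\<lambda>S. v (\<sigma> S)) ` \<S>)) face_of (convex hull (v ` K))"
proof -
  define \<phi> where "\<phi> x = c + f x" for x
  let ?P = "convex hull (v ` K)" and ?F = "convex hull (v ` \<S>)"
  have affine: "\<phi> ((1 - u) *\<^sub>R x + u *\<^sub>R y) = (1 - u) *\<^sub>R \<phi> x + u *\<^sub>R \<phi> y" for x y u
    by (simp add: \<phi>_def linear_add[OF lin] linear_diff[OF lin] linear_scale[OF lin] algebra_simps)
  have hull: "\<phi> ` (convex hull (v ` A)) = convex hull ((\<lambda>S. v (\<sigma> S)) ` A)" if "A \<subseteq> K" for A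
  proof -
    have "\<phi> ` (convex hull (v ` A)) = (+) c ` f ` (convex hull (v ` A))"
      by (simp add: \<phi>_def image_image)
    also have "\<dots> = convex hull ((+) c ` f ` v ` A)"
      by (simp add: convex_hull_linear_image[OF lin] convex_hull_translation)
    also have "(+) c ` f ` v ` A = (\<lambda>S. v (\<sigma> S)) ` A"
      using act that by (force simp: image_image)
    finally show ?thesis .
  qed
  have "(\<lambda>S. v (\<sigma> S)) ` K \<subseteq> v ` K"
    using inv by auto
  then have maps: "\<phi> x \<in> ?P" if "x \<in> ?P" for x
    using hull[of K] hull_mono that by (metis image_eqI order_refl subsetD)
  have "?P \<subseteq> {x. \<phi> (\<phi> x) = x}"
  proof (rule hull_minimal)
    show "v ` K \<subseteq> {x. \<phi> (\<phi> x) = x}"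
      using act inv by (auto simp: \<phi>_def)
    show "convex {x. \<phi> (\<phi> x) = x}"
      by (simp add: convex_alt affine)
  qed
  then have invol: "\<phi> (\<phi> x) = x" if "x \<in> ?P" for x
    using that by auto
  have FP: "?F \<subseteq> ?P"
    using face by (rule face_of_imp_subset)
  have "(\<phi> ` ?F) face_of ?P"
    unfolding face_of_def
  proof (intro conjI ballI impI)
    show "\<phi> ` ?F \<subseteq> ?P"
      using maps FP by auto
    show "convex (\<phi> ` ?F)"
      by (simp add: hull[OF sub])
    fix a b x
    assume a: "a \<in> ?P" and b: "b \<in> ?P" and x: "x \<in> \<phi> ` ?F" and seg: "x \<in> open_segment a b"
    have "\<phi> x \<in> ?F"
      using x invol FP by auto
    moreover have "\<phi> x \<in> open_segment (\<phi> a) (\<phi> b)"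
    proof -
      have "\<phi> a \<noteq> \<phi> b"
        using seg invol[OF a] invol[OF b] by (auto simp: in_segment)
      then show ?thesis
        using seg affine by (auto simp: in_segment)
    qed
    ultimately have "\<phi> a \<in> ?F \<and> \<phi> b \<in> ?F"
      using face maps[OF a] maps[OF b] unfolding face_of_def by blast
    then show "a \<in> \<phi> ` ?F" "b \<in> \<phi> ` ?F"
      using invol[OF a] invol[OF b] by (metis image_eqI)+
  qed
  then show ?thesis
    by (simp add: hull[OF sub])
qed

lemma lookup_scaleR:
  "Poly_Mapping.lookup (r *\<^sub>R x) i = r *\<^sub>R Poly_Mapping.lookup x i"
proof -
  have "finite {i. r *\<^sub>R Poly_Mapping.lookup x i \<noteq> 0}"
    by (rule finite_subset[OF _ finite_lookup[of x]]) auto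
  then show ?thesis
    by (simp add: scaleR_poly_mapping_def lookup_Abs_poly_mapping)
qed

lemma linear_lookup:
  "linear (\<lambda>x :: 'i \<Rightarrow>\<^sub>0 real. Poly_Mapping.lookup x i)"
  by (rule linearI) (simp_all add: lookup_add lookup_scaleR)

lemma linear_coord_vec:
  assumes "finite A" and "\<And>i. linear (\<lambda>x. g x i)"
  shows "linear (\<lambda>x. coord_vec A (g x))"
  using assms
  by (intro linearI poly_mapping_eqI)
    (simp_all add: lookup_coord_vec lookup_add lookup_scaleR linear_add[OF assms(2)] linear_scale[OF assms(2)])

text \<open>The generators are permuted by a relabelling of coordinates inside each facet, so the affine
  map is linear and a single step treats all of \<open>I\<close>.\<close>

lemma marg_face_switch:
  assumes \<Delta>: "simplicial_complex_on n \<Delta>"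
    and sub: "\<S> \<subseteq> Pow {1..n}" and I: "I \<subseteq> {1..n}"
    and face: "(convex hull (marg_vertex \<Delta> ` \<S>)) face_of Marg n \<Delta>"
  shows "(convex hull ((\<lambda>S. marg_vertex \<Delta> (sym_diff S I)) ` \<S>)) face_of Marg n \<Delta>"
proof -
  define g :: "(nat set \<times> nat set \<Rightarrow>\<^sub>0 real) \<Rightarrow> nat set \<times> nat set \<Rightarrow> real"
    where "g x p = Poly_Mapping.lookup x (sym_diff (fst p) (I \<inter> snd p), snd p)" for x p
  note fin = finite_marg_index[OF \<Delta>]
  have Marg: "Marg n \<Delta> = convex hull (marg_vertex \<Delta> ` Pow {1..n})"
    by (auto simp: Marg_def intro!: arg_cong[where f = "(hull) convex"])
  have "0 + coord_vec (marg_index \<Delta>) (g (marg_vertex \<Delta> S)) = marg_vertex \<Delta> (sym_diff S I)" for S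
  proof (rule poly_mapping_eqI)
    fix p :: "nat set \<times> nat set"
    obtain H F where p: "p = (H, F)"
      by (cases p)
    have "(S \<inter> F = sym_diff H (I \<inter> F)) = (sym_diff S I \<inter> F = H)" if "(H, F) \<in> marg_index \<Delta>"
      using that unfolding marg_index_def by blast
    moreover have "(sym_diff H (I \<inter> F), F) \<in> marg_index \<Delta>" if "(H, F) \<in> marg_index \<Delta>"
      using that unfolding marg_index_def by blast
    ultimately show "Poly_Mapping.lookup (0 + coord_vec (marg_index \<Delta>) (g (marg_vertex \<Delta> S))) p
        = Poly_Mapping.lookup (marg_vertex \<Delta> (sym_diff S I)) p"
      by (simp add: p g_def marg_vertex_def lookup_coord_vec[OF fin])
  qed
  moreover have "linear (\<lambda>x. coord_vec (marg_index \<Delta>) (g x))"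
    unfolding g_def by (intro linear_coord_vec fin linear_lookup)
  ultimately show ?thesis
    using face sub I unfolding Marg
    by (intro face_of_convex_hull_affine_involution[where c = 0 and \<sigma> = "\<lambda>S. sym_diff S I"
          and f = "\<lambda>x. coord_vec (marg_index \<Delta>) (g x)"]) auto
qed

text \<open>With the value at the empty set read as 1, the identity behind the map is that \<open>F\<close> lies in
  \<open>S \<triangle> {i}\<close>, for \<open>i \<in> F\<close>, iff \<open>F - {i}\<close> lies in \<open>S\<close> but \<open>F\<close> does not. The map uses only faces, because
  \<open>F - {i}\<close> is again one.\<close>

lemma corr_face_toggle:
  assumes \<Delta>: "simplicial_complex_on n \<Delta>"
    and sub: "\<S> \<subseteq> Pow {1..n}" and i: "i \<in> {1..n}"
    and face: "(convex hull (corr_vertex \<Delta> ` \<S>)) face_of Corr n \<Delta>"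
  shows "(convex hull ((\<lambda>S. corr_vertex \<Delta> (sym_diff S {i})) ` \<S>)) face_of Corr n \<Delta>"
proof -
  \<comment> \<open>The coordinate of a generator at the empty set is 0, so the value 1 that it stands for is
    supplied by the translation vector \<open>c\<close>, whose only possible nonzero entry is at \<open>{i}\<close>.\<close>
  define g :: "(nat set \<Rightarrow>\<^sub>0 real) \<Rightarrow> nat set \<Rightarrow> real"
    where "g x F = (if i \<in> F then Poly_Mapping.lookup x (F - {i}) - Poly_Mapping.lookup x F
                    else Poly_Mapping.lookup x F)" for x F
  define c :: "nat set \<Rightarrow>\<^sub>0 real"
    where "c = coord_vec (nonempty_faces \<Delta>) (\<lambda>F. if F = {i} then 1 else 0)"
  note fin = finite_nonempty_faces[OF \<Delta>]
  have Corr: "Corr n \<Delta> = convex hull (corr_vertex \<Delta> ` Pow {1..n})"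
    by (auto simp: Corr_def intro!: arg_cong[where f = "(hull) convex"])
  have "c + coord_vec (nonempty_faces \<Delta>) (g (corr_vertex \<Delta> S)) = corr_vertex \<Delta> (sym_diff S {i})"
    for S
  proof (rule poly_mapping_eqI)
    fix F
    have mem: "F - {i} \<in> nonempty_faces \<Delta> \<longleftrightarrow> F \<noteq> {i}" if "i \<in> F" "F \<in> nonempty_faces \<Delta>"
      using that \<Delta> by (auto simp: nonempty_faces_def simplicial_complex_on_def)
    have "F \<subseteq> sym_diff S {i} \<longleftrightarrow> F - {i} \<subseteq> S \<and> \<not> F \<subseteq> S" if "i \<in> F"
      using that by blast
    moreover have "F \<subseteq> sym_diff S {i} \<longleftrightarrow> F \<subseteq> S" if "i \<notin> F"
      using that by blast
    moreover have "F - {i} \<subseteq> S" if "F \<subseteq> S"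
      using that by blast
    ultimately show "Poly_Mapping.lookup (c + coord_vec (nonempty_faces \<Delta>) (g (corr_vertex \<Delta> S))) F
        = Poly_Mapping.lookup (corr_vertex \<Delta> (sym_diff S {i})) F"
      using mem
      by (cases "i \<in> F"; cases "F = {i}")
        (auto simp: lookup_add c_def g_def corr_vertex_def lookup_coord_vec[OF fin])
  qed
  moreover have "linear (\<lambda>x. coord_vec (nonempty_faces \<Delta>) (g x))"
  proof (intro linear_coord_vec fin)
    show "linear (\<lambda>x. g x F)" for F
      unfolding g_def by (cases "i \<in> F") (auto intro!: linear_lookup linear_compose_sub)
  qed
  ultimately show ?thesis
    using face sub i unfolding Corr
    by (intro face_of_convex_hull_affine_involution[where c = c and \<sigma> = "\<lambda>S. sym_diff S {i}"
          and f = "\<lambda>x. coord_vec (nonempty_faces \<Delta>) (g x)"]) auto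
qed

lemma corr_face_switch:
  assumes \<Delta>: "simplicial_complex_on n \<Delta>"
    and sub: "\<S> \<subseteq> Pow {1..n}" and I: "I \<subseteq> {1..n}"
    and face: "(convex hull (corr_vertex \<Delta> ` \<S>)) face_of Corr n \<Delta>"
  shows "(convex hull ((\<lambda>S. corr_vertex \<Delta> (sym_diff S I)) ` \<S>)) face_of Corr n \<Delta>"
proof -
  have "finite I"
    using I by (rule finite_subset) simp
  then show ?thesis
    using I
  proof (induction I)
    case empty
    then show ?case
      using face by simp
  next
    case (insert i I)
    let ?T = "(\<lambda>S. sym_diff S I) ` \<S>"
    have "(convex hull (corr_vertex \<Delta> ` ?T)) face_of Corr n \<Delta>"
      using insert by (simp add: image_image)
    moreover have "?T \<subseteq> Pow {1..n}"
      using sub insert.prems by auto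
    ultimately have "(convex hull ((\<lambda>S. corr_vertex \<Delta> (sym_diff S {i})) ` ?T)) face_of Corr n \<Delta>"
      using insert.prems by (intro corr_face_toggle[OF \<Delta>]) auto
    moreover have "sym_diff (sym_diff S I) {i} = sym_diff S (insert i I)" for S
      using insert.hyps by blast
    ultimately show ?case
      by (simp add: image_image)
  qed
qed

theorem corollary3p12:
  fixes n :: nat and \<Delta> :: "nat set set" and \<S> :: "nat set set" and I :: "nat set"
  assumes "simplicial_complex_on n \<Delta>"
    and "\<S> \<subseteq> Pow {1..n}"
    and "I \<subseteq> {1..n}"
  shows "((convex hull {marg_vertex \<Delta> S | S. S \<in> \<S>}) face_of Marg n \<Delta> \<longrightarrow>
            (convex hull {marg_vertex \<Delta> (sym_diff S I) | S. S \<in> \<S>}) face_of Marg n \<Delta>)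
       \<and> ((convex hull {corr_vertex \<Delta> S | S. S \<in> \<S>}) face_of Corr n \<Delta> \<longrightarrow>
            (convex hull {corr_vertex \<Delta> (sym_diff S I) | S. S \<in> \<S>}) face_of Corr n \<Delta>)"
  unfolding Setcompr_eq_image
  using marg_face_switch[OF assms] corr_face_switch[OF assms] by blast

end
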